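(* Let $\boldsymbol{X}=(X_1,\dots,X_d)$ follow the multivariate common shock Poisson distribution with parameters $(\theta_0,\theta_1,\dots,\theta_d)\in(0,\infty)^{d+1}$, and let $M^{\boldsymbol X}=\max(X_1,\dots,X_d)$ and $m^{\boldsymbol X}=\min(X_1,\dots,X_d)$. Then for every $x\in\mathbb N=\{0,1,2,\dots\}$ the cumulative distribution functions of $M^{\boldsymbol X}$ and $m^{\boldsymbol X}$ are $$F_{M^{\boldsymbol X}}(x)=\sum_{y=0}^{x}\frac{\theta_0^{y}e^{-\theta_0}\prod_{j=1}^{d}\Gamma(x-y+1,\theta_j)}{\Gamma(y+1)\,\Gamma^{d}(x-y+1)},$$ $$F_{m^{\boldsymbol X}}(x)=\sum_{y=0}^{x}\frac{\theta_0^{y}e^{-\theta_0}\left[\Gamma^{d}(x-y+1)-\prod_{j=1}^{d}\gamma(x-y+1,\theta_j)\right]}{\Gamma(y+1)\,\Gamma^{d}(x-y+1)}.$$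
   Context: A random vector $(X_1,\dots,X_d)$ has the multivariate common shock Poisson distribution with parameters $(\theta_0,\theta_1,\dots,\theta_d)\in(0,\infty)^{d+1}$ if $X_i=Y_0+Y_i$ for $i=1,\dots,d$, where $Y_0,Y_1,\dots,Y_d$ are mutually independent and $Y_i$ is Poisson distributed with rate $\theta_i$, $i=0,1,\dots,d$. $\Gamma(z)=\int_0^\infty t^{z-1}e^{-t}\,dt$, $\Gamma(z,x)=\int_x^\infty t^{z-1}e^{-t}\,dt$ and $\gamma(z,x)=\int_0^x t^{z-1}e^{-t}\,dt$ are the gamma, upper incomplete gamma and lower incomplete gamma functions; $\Gamma^d(z)=(\Gamma(z))^d$. *)

theory Defs
  imports "HOL-Probability.Probability"
begin

definition upper_incomplete_Gamma :: "real \<Rightarrow> real \<Rightarrow> real" where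
  "upper_incomplete_Gamma z x = integral {x..} (\<lambda>t. t powr (z - 1) * exp (- t))"

definition lower_incomplete_Gamma :: "real \<Rightarrow> real \<Rightarrow> real" where
  "lower_incomplete_Gamma z x = integral {0..x} (\<lambda>t. t powr (z - 1) * exp (- t))"

definition common_shock_representation ::
  "'a measure \<Rightarrow> nat \<Rightarrow> (nat \<Rightarrow> real) \<Rightarrow> (nat \<Rightarrow> 'a \<Rightarrow> nat) \<Rightarrow> bool" where
  "common_shock_representation M d \<theta> X \<longleftrightarrow>
     prob_space M \<and>
     (\<exists>Y :: nat \<Rightarrow> 'a \<Rightarrow> nat.
        prob_space.indep_vars M (\<lambda>_. count_space UNIV) Y {0..d} \<and>
        (\<forall>i\<in>{0..d}. distr M (count_space UNIV) (Y i) = measure_pmf (poisson_pmf (\<theta> i))) \<and>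
        (\<forall>i\<in>{1..d}. \<forall>\<omega>\<in>space M. X i \<omega> = Y 0 \<omega> + Y i \<omega>))"

definition vector_law :: "'a measure \<Rightarrow> nat \<Rightarrow> (nat \<Rightarrow> 'a \<Rightarrow> nat) \<Rightarrow> (nat \<Rightarrow> nat) measure" where
  "vector_law M d X =
     distr M (PiM {1..d} (\<lambda>_. count_space UNIV)) (\<lambda>\<omega>. \<lambda>i\<in>{1..d}. X i \<omega>)"

text \<open>
  Following a distribution is a property of the law of the vector: the independent shocks may live
  on a probability space \<open>N\<close> other than \<open>M\<close>. Fixing the type of the points of \<open>N\<close> to
  \<open>nat \<Rightarrow> nat\<close> loses nothing, since the shocks can be realised as coordinates; see
  \<open>common_shock_poissonI\<close> below.
\<close>

definition common_shock_poisson ::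
  "'a measure \<Rightarrow> nat \<Rightarrow> (nat \<Rightarrow> real) \<Rightarrow> (nat \<Rightarrow> 'a \<Rightarrow> nat) \<Rightarrow> bool" where
  "common_shock_poisson M d \<theta> X \<longleftrightarrow>
     prob_space M \<and>
     (\<forall>i\<in>{1..d}. X i \<in> measurable M (count_space UNIV)) \<and>
     (\<exists>(N :: (nat \<Rightarrow> nat) measure) Z.
        common_shock_representation N d \<theta> Z \<and> vector_law M d X = vector_law N d Z)"

lemma common_shock_poissonI:
  fixes N :: "'b measure"
  assumes "prob_space M"
    and X: "\<And>i. i \<in> {1..d} \<Longrightarrow> X i \<in> measurable M (count_space UNIV)"
    and rep: "common_shock_representation N d \<theta> Z"
    and law: "vector_law M d X = vector_law N d Z"
  shows "common_shock_poisson M d \<theta> X"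
proof -
  interpret prob_space N
    using rep by (simp add: common_shock_representation_def)
  obtain Y where ind: "indep_vars (\<lambda>_. count_space UNIV) Y {0..d}"
    and poi: "\<And>i. i \<in> {0..d} \<Longrightarrow> distr N (count_space UNIV) (Y i) = measure_pmf (poisson_pmf (\<theta> i))"
    and Z: "\<And>i \<omega>. i \<in> {1..d} \<Longrightarrow> \<omega> \<in> space N \<Longrightarrow> Z i \<omega> = Y 0 \<omega> + Y i \<omega>"
    using rep by (auto simp: common_shock_representation_def)
  have Y[measurable]: "Y i \<in> measurable N (count_space UNIV)" if "i \<in> {0..d}" for i
    using ind that by (auto simp: indep_vars_def)
  define P where "P = PiM {0..d} (\<lambda>_. count_space (UNIV :: nat set))"
  define f where "f = (\<lambda>\<omega>. \<lambda>i\<in>{0..d}. Y i \<omega>)"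
  define K where "K = distr N P f"
  have f[measurable]: "f \<in> measurable N P"
    unfolding f_def P_def by (rule measurable_restrict) (use Y in auto)
  interpret K: prob_space K
    unfolding K_def by (rule prob_space_distr) (rule f)
  have coord: "(\<lambda>w. w i) \<in> measurable P (count_space UNIV)" if "i \<in> {0..d}" for i
    unfolding P_def by (rule measurable_component_singleton) (use that in auto)
  have coordK: "(\<lambda>w. w i) \<in> measurable K (count_space UNIV)" if "i \<in> {0..d}" for i
    using coord[OF that] by (simp add: K_def)
  have dK: "distr K (count_space UNIV) (\<lambda>w. w i) = distr N (count_space UNIV) (Y i)"
    if "i \<in> {0..d}" for i
    unfolding K_def using that
    by (subst distr_distr[OF coord f]) (auto simp: f_def o_def)
  have eqP: "distr K (PiM {0..d} (\<lambda>_. count_space UNIV)) (\<lambda>w. \<lambda>i\<in>{0..d}. w i) = K"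
  proof -
    have m: "(\<lambda>w. \<lambda>i\<in>{0..d}. w i) \<in> measurable P (PiM {0..d} (\<lambda>_. count_space (UNIV :: nat set)))"
      by (rule measurable_restrict) (use coord in auto)
    show ?thesis
      unfolding K_def
      by (subst distr_distr[OF m f]) (auto simp: P_def f_def o_def intro!: distr_cong)
  qed
  have indK: "K.indep_vars (\<lambda>_. count_space UNIV) (\<lambda>i w. w i) {0..d}"
  proof -
    have "K = PiM {0..d} (\<lambda>i. distr N (count_space UNIV) (Y i))"
      using ind Y by (subst (asm) indep_vars_iff_distr_eq_PiM') (auto simp: K_def P_def f_def)
    also have "\<dots> = PiM {0..d} (\<lambda>i. distr K (count_space UNIV) (\<lambda>w. w i))"
      by (intro PiM_cong) (auto simp: dK)
    finally have K_eq: "K = PiM {0..d} (\<lambda>i. distr K (count_space UNIV) (\<lambda>w. w i))" .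
    show ?thesis
      by (subst K.indep_vars_iff_distr_eq_PiM')
        (use coordK eqP K_eq in auto)
  qed
  define W where "W = (\<lambda>(i::nat) w. w 0 + w i :: nat)"
  have "common_shock_representation K d \<theta> W"
    unfolding common_shock_representation_def
    using indK K.prob_space_axioms by (auto simp: dK poi W_def intro!: exI[of _ "\<lambda>i w. w i"])
  moreover have "vector_law N d Z = vector_law K d W"
  proof -
    have Wi: "W i \<in> measurable P (count_space UNIV)" if "i \<in> {1..d}" for i
    proof -
      have c: "(\<lambda>w. w 0) \<in> measurable P (count_space UNIV)"
        "(\<lambda>w. w i) \<in> measurable P (count_space UNIV)"
        using that by (auto intro!: coord)
      have "(\<lambda>w. a + w i) \<in> measurable P (count_space UNIV)" for a
        by (rule measurable_compose[OF c(2)]) simp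
      then show ?thesis
        unfolding W_def by (rule measurable_compose_countable) (rule c(1))
    qed
    have m: "(\<lambda>w. \<lambda>i\<in>{1..d}. W i w) \<in> measurable P (PiM {1..d} (\<lambda>_. count_space UNIV))"
      by (rule measurable_restrict) (use Wi in auto)
    show ?thesis
      unfolding vector_law_def K_def
      by (subst distr_distr[OF m f]) (auto simp: W_def f_def Z o_def fun_eq_iff intro!: distr_cong)
  qed
  ultimately show ?thesis
    using assms(1) X law by (auto simp: common_shock_poisson_def)
qed

end

theory Submission
  imports Defs
begin

text \<open>
  The Poisson--gamma duality identifies \<open>\<Gamma>(n+1, \<theta>) / n!\<close> and \<open>\<gamma>(n+1, \<theta>) / n!\<close> with the
  probabilities that a Poisson variable of rate \<open>\<theta>\<close> is at most \<open>n\<close>, respectively exceeds \<open>n\<close>.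
  Conditionally on the common shock \<open>Y\<^sub>0 = y\<close> with \<open>y \<le> x\<close>, the maximum is at most \<open>x\<close> iff all
  \<open>Y\<^sub>j\<close> are at most \<open>x - y\<close>, and the minimum exceeds \<open>x\<close> iff all \<open>Y\<^sub>j\<close> exceed \<open>x - y\<close>. For
  \<open>Y\<^sub>0 > x\<close> both extremes exceed \<open>x\<close>, so summing over \<open>y \<le> x\<close> gives both formulas.
\<close>

section \<open>Incomplete gamma functions at integers as Poisson probabilities\<close>

lemma measure_poisson_atMost:
  assumes "a > 0"
  shows "measure_pmf.prob (poisson_pmf a) {..n} = (\<Sum>k\<le>n. a ^ k * exp (- a) / fact k)"
  using assms by (simp add: measure_measure_pmf_finite)

lemma measure_pmf_greaterThan:
  "measure_pmf.prob p {n<..} = 1 - measure_pmf.prob p {..n}" for n :: "'a::linorder"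
  using measure_pmf.prob_compl[of "{..n}" p] by (simp add: Compl_eq_Diff_UNIV[symmetric])

text \<open>Repeated integration by parts turns the integral of \<open>t ^ n * exp (- t)\<close>
  over \<open>{0..a}\<close> into \<open>fact n\<close> times one minus a Poisson distribution
  function. The \<open>has_integral\<close> form is kept because the upper function is obtained by
  subtracting this integral.\<close>

lemma has_integral_lower_incomplete_Gamma:
  assumes "a > 0"
  shows "((\<lambda>t. t powr real n * exp (- t)) has_integral
           fact n * measure_pmf.prob (poisson_pmf a) {n<..}) {0..a}"
proof -
  let ?r = "fact n * measure_pmf.prob (poisson_pmf a) {n<..}"
  \<comment> \<open>This is the shape in which the closed form of the nonnegative integral is
    available.\<close>
  have r: "?r = (1 - (\<Sum>k\<le>n. a ^ k * exp (- a) / fact k)) * fact n"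
    using assms by (simp add: measure_pmf_greaterThan measure_poisson_atMost)
  have "((\<lambda>t. t ^ n * exp (- t) * indicator {0..a} t) has_integral ?r) UNIV"
  proof (rule nn_integral_has_integral)
    have "(\<integral>\<^sup>+ t. ennreal (t ^ n * exp (- t) * indicator {0..a} t) \<partial>lborel) =
        (\<integral>\<^sup>+ t. ennreal (t ^ n * exp (- t)) * indicator {0..a} t \<partial>lborel)"
      by (intro nn_integral_cong) (auto split: split_indicator)
    also have "\<dots> = ennreal ?r"
      using assms by (simp add: nn_intergal_power_times_exp_Icc r)
    finally show "(\<integral>\<^sup>+ t. ennreal (t ^ n * exp (- t) * indicator {0..a} t) \<partial>lborel) = ennreal ?r" .
  qed (auto split: split_indicator)
  then have "((\<lambda>t. if t \<in> {0..a} then t ^ n * exp (- t) else 0) has_integral ?r) UNIV"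
    by (rule has_integral_eq[rotated]) (auto split: split_indicator)
  then have "((\<lambda>t. t ^ n * exp (- t)) has_integral ?r) {0..a}"
    by (simp only: has_integral_restrict_UNIV)
  \<comment> \<open>\<open>0 powr 0 = 0\<close> differs from \<open>0 ^ 0 = 1\<close>, so the endpoint has to be discarded.\<close>
  then show ?thesis
    by (rule has_integral_spike[of "{0}", rotated 2]) (auto simp: powr_realpow)
qed

lemma lower_incomplete_Gamma_eq_poisson:
  assumes "a > 0"
  shows "lower_incomplete_Gamma (real n + 1) a = fact n * measure_pmf.prob (poisson_pmf a) {n<..}"
  using has_integral_lower_incomplete_Gamma[OF assms, of n]
  by (simp add: lower_incomplete_Gamma_def integral_unique)

text \<open>The integral over the whole half-line is \<open>Gamma (n + 1)\<close>, that is
  \<open>fact n\<close>. Removing the lower part leaves the complementary Poisson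
  probability.\<close>

lemma upper_incomplete_Gamma_eq_poisson:
  assumes "a > 0"
  shows "upper_incomplete_Gamma (real n + 1) a = fact n * measure_pmf.prob (poisson_pmf a) {..n}"
proof -
  let ?f = "\<lambda>t::real. t powr real n * exp (- t)"
  have "(?f has_integral fact n) {0..}"
    using Gamma_integral_real[of "real n + 1"] Gamma_fact[of n, where ?'a = real]
    by (simp add: add.commute[of 1] exp_minus divide_inverse)
  from has_integral_setdiff[OF this has_integral_lower_incomplete_Gamma[OF assms, of n]]
  have "(?f has_integral fact n * measure_pmf.prob (poisson_pmf a) {..n}) ({0..} - {0..a})"
    by (auto simp: measure_pmf_greaterThan algebra_simps)
  also have "{0..} - {0..a} = {a<..}"
    using assms by auto
  finally have "(?f has_integral fact n * measure_pmf.prob (poisson_pmf a) {..n}) {a<..}" .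
  \<comment> \<open>The set difference has lost the endpoint \<open>a\<close>, which the definition
    of the upper function includes; a single point is negligible.\<close>
  then have "(?f has_integral fact n * measure_pmf.prob (poisson_pmf a) {..n}) {a..}"
    by (rule has_integral_spike_set_eq[THEN iffD1, rotated 2])
       (rule negligible_subset[of "{a}"]; auto)+
  then show ?thesis
    by (simp add: upper_incomplete_Gamma_def integral_unique)
qed

section \<open>Conditioning on the common shock\<close>

text \<open>Splitting by the value of \<open>Y 0\<close> makes the event a finite disjoint union,
  and independence factorises each piece. The set \<open>B\<close> is left free so that
  \<open>{..x}\<close> serves the maximum, \<open>{x<..}\<close> the minimum and \<open>UNIV\<close>
  the law of \<open>Y 0\<close> alone.\<close>

lemma (in prob_space) prob_common_shock:
  fixes Y :: "nat \<Rightarrow> 'a \<Rightarrow> nat"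
  assumes ind: "indep_vars (\<lambda>_. count_space UNIV) Y {0..d}"
    and distr_Y: "\<And>i. i \<in> {0..d} \<Longrightarrow> distr M (count_space UNIV) (Y i) = measure_pmf (p i)"
  shows "prob {\<omega>\<in>space M. Y 0 \<omega> \<le> x \<and> (\<forall>j\<in>{1..d}. Y 0 \<omega> + Y j \<omega> \<in> B)} =
    (\<Sum>y=0..x. pmf (p 0) y * (\<Prod>j=1..d. measure_pmf.prob (p j) {k. y + k \<in> B}))"
proof -
  have Y[measurable]: "Y i \<in> measurable M (count_space UNIV)" if "i \<in> {0..d}" for i
    using ind that by (auto simp: indep_vars_def)
  have prob_Y: "prob (Y i -` A \<inter> space M) = measure_pmf.prob (p i) A" if "i \<in> {0..d}" for i A
    using measure_distr[OF Y[OF that], of A] by (simp add: distr_Y[OF that])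
  \<comment> \<open>Index 0 gets a singleton, so that \<open>E y\<close> imposes one condition per
    index, including the shared one, and independence applies to all of them at once.\<close>
  define A where "A y i = (if i = 0 then {y} else {k. y + k \<in> B})" for y i :: nat
  define E where "E y = (\<Inter>i\<in>{0..d}. Y i -` A y i \<inter> space M)" for y
  have E_sets: "E y \<in> events" for y
    unfolding E_def by (rule sets.finite_INT) (auto intro!: measurable_sets[OF Y])
  have "{\<omega>\<in>space M. Y 0 \<omega> \<le> x \<and> (\<forall>j\<in>{1..d}. Y 0 \<omega> + Y j \<omega> \<in> B)} = (\<Union>y\<in>{0..x}. E y)"
  proof (intro set_eqI iffI)
    fix \<omega> assume "\<omega> \<in> {\<omega>\<in>space M. Y 0 \<omega> \<le> x \<and> (\<forall>j\<in>{1..d}. Y 0 \<omega> + Y j \<omega> \<in> B)}"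
    then have "\<omega> \<in> E (Y 0 \<omega>)" "Y 0 \<omega> \<in> {0..x}"
      by (auto simp: E_def A_def)
    then show "\<omega> \<in> (\<Union>y\<in>{0..x}. E y)"
      by blast
  next
    fix \<omega> assume "\<omega> \<in> (\<Union>y\<in>{0..x}. E y)"
    then obtain y where y: "y \<le> x" and E: "\<And>i. i \<le> d \<Longrightarrow> \<omega> \<in> space M \<and> Y i \<omega> \<in> A y i"
      by (auto simp: E_def)
    from E[of 0] have "\<omega> \<in> space M" "Y 0 \<omega> = y"
      by (auto simp: A_def)
    moreover have "y + Y j \<omega> \<in> B" if "j \<in> {1..d}" for j
      using E[of j] that by (auto simp: A_def)
    ultimately show "\<omega> \<in> {\<omega>\<in>space M. Y 0 \<omega> \<le> x \<and> (\<forall>j\<in>{1..d}. Y 0 \<omega> + Y j \<omega> \<in> B)}"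
      using y by simp
  qed
  also have "prob \<dots> = (\<Sum>y=0..x. prob (E y))"
  proof (rule finite_measure_finite_Union)
    have "E y \<subseteq> Y 0 -` {y}" for y
      by (force simp: E_def A_def)
    then show "disjoint_family_on E {0..x}"
      unfolding disjoint_family_on_def by blast
  qed (use E_sets in auto)
  also have "\<dots> = (\<Sum>y=0..x. pmf (p 0) y * (\<Prod>j=1..d. measure_pmf.prob (p j) {k. y + k \<in> B}))"
  proof (rule sum.cong)
    fix y
    have "prob (E y) = (\<Prod>i=0..d. prob (Y i -` A y i \<inter> space M))"
      unfolding E_def by (rule indep_varsD_finite[OF ind]) auto
    also have "\<dots> = (\<Prod>i=0..d. measure_pmf.prob (p i) (A y i))"
      by (intro prod.cong prob_Y) auto
    also have "\<dots> = pmf (p 0) y * (\<Prod>j=1..d. measure_pmf.prob (p j) (A y j))"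
      by (simp add: prod.atLeast_Suc_atMost A_def pmf.rep_eq)
    also have "\<dots> = pmf (p 0) y * (\<Prod>j=1..d. measure_pmf.prob (p j) {k. y + k \<in> B})"
      by (simp add: A_def)
    finally show "prob (E y) = \<dots>" .
  qed simp
  finally show ?thesis .
qed

section \<open>Laws, distribution functions and measurability of the extremes\<close>

text \<open>Serves to compare vectors on different probability spaces through their laws. Boxes with
  equal sides suffice: a maximum at most \<open>x\<close> and a minimum above \<open>x\<close> both
  say that all coordinates lie in one common set.\<close>

lemma measure_vector_law_box:
  assumes X: "\<And>i. i \<in> {1..d} \<Longrightarrow> X i \<in> measurable M (count_space UNIV)"
  shows "measure (vector_law M d X) (PiE {1..d} (\<lambda>_. B)) =
    measure M {\<omega>\<in>space M. \<forall>i\<in>{1..d}. X i \<omega> \<in> B}"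
proof -
  have "(\<lambda>\<omega>. \<lambda>i\<in>{1..d}. X i \<omega>) \<in> measurable M (PiM {1..d} (\<lambda>_. count_space UNIV))"
    by (rule measurable_restrict) (use X in auto)
  moreover have "PiE {1..d} (\<lambda>_. B) \<in> sets (PiM {1..d} (\<lambda>_. count_space UNIV))"
    by (rule sets_PiM_I_finite) auto
  ultimately show ?thesis
    unfolding vector_law_def
    by (subst measure_distr) (auto simp: Pi_iff intro!: arg_cong[where f = "measure M"])
qed

lemma cdf_distr_real:
  assumes "f \<in> measurable M (count_space UNIV)"
  shows "cdf (distr M borel (\<lambda>\<omega>. real (f \<omega>))) (real x) = measure M {\<omega>\<in>space M. f \<omega> \<le> x}"
proof -
  have "(\<lambda>\<omega>. real (f \<omega>)) \<in> borel_measurable M"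
    using assms by (rule measurable_compose) simp
  then show ?thesis
    unfolding cdf_def
    by (subst measure_distr) (auto intro!: arg_cong[where f = "measure M"])
qed

lemma measurable_Max_image:
  fixes X :: "'i \<Rightarrow> 'a \<Rightarrow> nat"
  assumes "finite I" "I \<noteq> {}" "\<And>i. i \<in> I \<Longrightarrow> X i \<in> measurable M (count_space UNIV)"
  shows "(\<lambda>\<omega>. Max ((\<lambda>i. X i \<omega>) ` I)) \<in> measurable M (count_space UNIV)"
  using assms
proof (induction I rule: finite_ne_induct)
  case (insert i I)
  \<comment> \<open>The second argument may be frozen to a constant, since the maximum over the
    remaining indices takes only countably many values.\<close>
  have "(\<lambda>\<omega>. max (X i \<omega>) n) \<in> measurable M (count_space UNIV)" for n
    by (rule measurable_compose[OF insert.prems]) simp_all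
  moreover have "(\<lambda>\<omega>. Max ((\<lambda>i. X i \<omega>) ` I)) \<in> measurable M (count_space UNIV)"
    using insert.prems by (intro insert.IH) simp
  ultimately have "(\<lambda>\<omega>. max (X i \<omega>) (Max ((\<lambda>i. X i \<omega>) ` I))) \<in> measurable M (count_space UNIV)"
    by (rule measurable_compose_countable)
  with insert.hyps show ?case
    by simp
qed simp

lemma measurable_Min_image:
  fixes X :: "'i \<Rightarrow> 'a \<Rightarrow> nat"
  assumes "finite I" "I \<noteq> {}" "\<And>i. i \<in> I \<Longrightarrow> X i \<in> measurable M (count_space UNIV)"
  shows "(\<lambda>\<omega>. Min ((\<lambda>i. X i \<omega>) ` I)) \<in> measurable M (count_space UNIV)"
  using assms
proof (induction I rule: finite_ne_induct)
  case (insert i I)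
  have "(\<lambda>\<omega>. min (X i \<omega>) n) \<in> measurable M (count_space UNIV)" for n
    by (rule measurable_compose[OF insert.prems]) simp_all
  moreover have "(\<lambda>\<omega>. Min ((\<lambda>i. X i \<omega>) ` I)) \<in> measurable M (count_space UNIV)"
    using insert.prems by (intro insert.IH) simp
  ultimately have "(\<lambda>\<omega>. min (X i \<omega>) (Min ((\<lambda>i. X i \<omega>) ` I))) \<in> measurable M (count_space UNIV)"
    by (rule measurable_compose_countable)
  with insert.hyps show ?case
    by simp
qed simp

theorem theorem3p1:
  fixes M :: "'a measure" and d :: nat and \<theta> :: "nat \<Rightarrow> real"
    and X :: "nat \<Rightarrow> 'a \<Rightarrow> nat" and x :: nat
  assumes "d \<ge> 1"
    and "\<And>i. i \<in> {0..d} \<Longrightarrow> \<theta> i > 0"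
    and "common_shock_poisson M d \<theta> X"
  shows "cdf (distr M borel (\<lambda>\<omega>. real (Max ((\<lambda>i. X i \<omega>) ` {1..d})))) (real x) =
      (\<Sum>y=0..x. \<theta> 0 ^ y * exp (- \<theta> 0) *
          (\<Prod>j=1..d. upper_incomplete_Gamma (real x - real y + 1) (\<theta> j)) /
          (Gamma (real y + 1) * Gamma (real x - real y + 1) ^ d)) \<and>
    cdf (distr M borel (\<lambda>\<omega>. real (Min ((\<lambda>i. X i \<omega>) ` {1..d})))) (real x) =
      (\<Sum>y=0..x. \<theta> 0 ^ y * exp (- \<theta> 0) *
          (Gamma (real x - real y + 1) ^ d -
            (\<Prod>j=1..d. lower_incomplete_Gamma (real x - real y + 1) (\<theta> j))) /
          (Gamma (real y + 1) * Gamma (real x - real y + 1) ^ d))"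
proof -
  note d = assms(1) and \<theta> = assms(2)
  obtain N :: "(nat \<Rightarrow> nat) measure" and Z where M: "prob_space M"
    and X: "\<And>i. i \<in> {1..d} \<Longrightarrow> X i \<in> measurable M (count_space UNIV)"
    and rep: "common_shock_representation N d \<theta> Z" and law: "vector_law M d X = vector_law N d Z"
    using assms(3) by (auto simp: common_shock_poisson_def)
  interpret M: prob_space M by (fact M)
  interpret N: prob_space N using rep by (simp add: common_shock_representation_def)
  obtain Y where ind: "N.indep_vars (\<lambda>_. count_space UNIV) Y {0..d}"
    and Y_poisson: "\<And>i. i \<in> {0..d} \<Longrightarrow>
      distr N (count_space UNIV) (Y i) = measure_pmf (poisson_pmf (\<theta> i))"
    and Z: "\<And>i \<omega>. i \<in> {1..d} \<Longrightarrow> \<omega> \<in> space N \<Longrightarrow> Z i \<omega> = Y 0 \<omega> + Y i \<omega>"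
    using rep by (auto simp: common_shock_representation_def)
  have Y: "Y i \<in> measurable N (count_space UNIV)" if "i \<in> {0..d}" for i
    using ind that by (auto simp: N.indep_vars_def)
  have YY: "(\<lambda>\<omega>. Y 0 \<omega> + Y i \<omega>) \<in> measurable N (count_space UNIV)" if "i \<in> {1..d}" for i
    using Y[of 0] Y[of i] that by simp
  have Z_meas: "Z i \<in> measurable N (count_space UNIV)" if "i \<in> {1..d}" for i
    using measurable_cong[of N "Z i" "\<lambda>\<omega>. Y 0 \<omega> + Y i \<omega>"] YY[OF that] Z that by blast
  \<comment> \<open>The passage from \<open>M\<close> to \<open>N\<close>: \<open>X\<close> agrees
    with sums of shocks only in law, so only probabilities can be transferred, not pointwise
    identities.\<close>
  have box: "M.prob {\<omega>\<in>space M. \<forall>i\<in>{1..d}. X i \<omega> \<in> B} =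
      N.prob {\<omega>\<in>space N. \<forall>i\<in>{1..d}. Y 0 \<omega> + Y i \<omega> \<in> B}" for B
  proof -
    have "M.prob {\<omega>\<in>space M. \<forall>i\<in>{1..d}. X i \<omega> \<in> B} =
        N.prob {\<omega>\<in>space N. \<forall>i\<in>{1..d}. Z i \<omega> \<in> B}"
      using measure_vector_law_box[of d X M B] measure_vector_law_box[of d Z N B] X Z_meas law
      by simp
    also have "\<dots> = N.prob {\<omega>\<in>space N. \<forall>i\<in>{1..d}. Y 0 \<omega> + Y i \<omega> \<in> B}"
      by (intro arg_cong[where f = N.prob]) (auto simp: Z)
    finally show ?thesis .
  qed
  note shock = N.prob_common_shock[OF ind Y_poisson, of x]
  have pmf0: "pmf (poisson_pmf (\<theta> 0)) y = \<theta> 0 ^ y * exp (- \<theta> 0) / Gamma (real y + 1)" for y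
    using \<theta>[of 0] Gamma_fact[of y, where ?'a = real] by (simp add: add.commute[of 1])
  \<comment> \<open>The range \<open>y \<le> x\<close> of the sums ensures that the real difference
    equals the truncated natural one.\<close>
  have Gamma_diff: "Gamma (real x - real y + 1) = fact (x - y)" if "y \<le> x" for y
    using that Gamma_fact[of "x - y", where ?'a = real] by (simp add: of_nat_diff add.commute[of 1])

  \<comment> \<open>The distribution function of the maximum\<close>
  have "M.prob {\<omega>\<in>space M. Max ((\<lambda>i. X i \<omega>) ` {1..d}) \<le> x} =
      M.prob {\<omega>\<in>space M. \<forall>i\<in>{1..d}. X i \<omega> \<in> {..x}}"
    using d by (intro arg_cong[where f = M.prob]) auto
  \<comment> \<open>The bound on \<open>Y 0\<close> comes for free: index 1 exists because
    \<open>d \<ge> 1\<close>, and \<open>Y 0 + Y 1 \<le> x\<close> forces it.\<close>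
  also have "\<dots> = N.prob {\<omega>\<in>space N. Y 0 \<omega> \<le> x \<and> (\<forall>i\<in>{1..d}. Y 0 \<omega> + Y i \<omega> \<in> {..x})}"
    unfolding box using d
    by (intro arg_cong[where f = N.prob]) (fastforce dest: bspec[where x = 1])
  also have "\<dots> = (\<Sum>y=0..x. pmf (poisson_pmf (\<theta> 0)) y *
      (\<Prod>j=1..d. measure_pmf.prob (poisson_pmf (\<theta> j)) {k. y + k \<in> {..x}}))"
    by (rule shock)
  also have "\<dots> = (\<Sum>y=0..x. \<theta> 0 ^ y * exp (- \<theta> 0) *
          (\<Prod>j=1..d. upper_incomplete_Gamma (real x - real y + 1) (\<theta> j)) /
          (Gamma (real y + 1) * Gamma (real x - real y + 1) ^ d))"
  proof (rule sum.cong)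
    fix y assume "y \<in> {0..x}"
    then have y: "y \<le> x" by simp
    have set_eq: "{k. y + k \<in> {..x}} = {..x - y}" using y by auto
    have "(\<Prod>j=1..d. upper_incomplete_Gamma (real x - real y + 1) (\<theta> j)) =
        (\<Prod>j=1..d. fact (x - y) * measure_pmf.prob (poisson_pmf (\<theta> j)) {..x - y})"
      using \<theta> y upper_incomplete_Gamma_eq_poisson[of _ "x - y"]
      by (intro prod.cong) (auto simp: of_nat_diff)
    also have "\<dots> = fact (x - y) ^ d * (\<Prod>j=1..d. measure_pmf.prob (poisson_pmf (\<theta> j)) {..x - y})"
      by (simp add: prod.distrib)
    finally show "pmf (poisson_pmf (\<theta> 0)) y *
        (\<Prod>j=1..d. measure_pmf.prob (poisson_pmf (\<theta> j)) {k. y + k \<in> {..x}}) =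
        \<theta> 0 ^ y * exp (- \<theta> 0) *
          (\<Prod>j=1..d. upper_incomplete_Gamma (real x - real y + 1) (\<theta> j)) /
          (Gamma (real y + 1) * Gamma (real x - real y + 1) ^ d)"
      unfolding set_eq pmf0 Gamma_diff[OF y] by simp
  qed simp
  finally have max: "M.prob {\<omega>\<in>space M. Max ((\<lambda>i. X i \<omega>) ` {1..d}) \<le> x} = \<dots>" .

  \<comment> \<open>The distribution function of the minimum, by complementation\<close>
  let ?A = "{\<omega>\<in>space N. Y 0 \<omega> \<le> x}"
  let ?C = "{\<omega>\<in>space N. \<forall>i\<in>{1..d}. Y 0 \<omega> + Y i \<omega> \<in> {x<..}}"
  let ?B = "{\<omega>\<in>space N. Y 0 \<omega> \<le> x \<and> (\<forall>i\<in>{1..d}. Y 0 \<omega> + Y i \<omega> \<in> {x<..})}"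
  have A: "?A \<in> N.events"
    using measurable_sets[OF Y[of 0], of "{..x}"] by (simp add: vimage_def Int_def conj_commute)
  have C: "?C \<in> N.events"
    by (rule sets.sets_Collect_finite_All')
       (use d YY measurable_sets[OF YY, of _ "{x<..}"] in
         \<open>auto simp: vimage_def Int_def conj_commute\<close>)
  have "?B = ?A \<inter> ?C" by auto
  with A C have B: "?B \<in> N.events" by auto
  have "{\<omega>\<in>space M. \<forall>i\<in>{1..d}. X i \<omega> \<in> {x<..}} \<in> M.events"
    by (rule sets.sets_Collect_finite_All')
       (use d measurable_sets[OF X, of _ "{x<..}"] in
         \<open>auto simp: vimage_def Int_def conj_commute\<close>)
  then have "M.prob (space M - {\<omega>\<in>space M. \<forall>i\<in>{1..d}. X i \<omega> \<in> {x<..}}) =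
      1 - M.prob {\<omega>\<in>space M. \<forall>i\<in>{1..d}. X i \<omega> \<in> {x<..}}"
    by (rule M.prob_compl)
  moreover have "{\<omega>\<in>space M. Min ((\<lambda>i. X i \<omega>) ` {1..d}) \<le> x} =
      space M - {\<omega>\<in>space M. \<forall>i\<in>{1..d}. X i \<omega> \<in> {x<..}}"
    using d by (auto simp: Min_le_iff not_less)
  ultimately have "M.prob {\<omega>\<in>space M. Min ((\<lambda>i. X i \<omega>) ` {1..d}) \<le> x} = 1 - N.prob ?C"
    by (simp only: box)
  also have "\<dots> = N.prob (space N - ?C)"
    using C by (simp only: N.prob_compl)
  \<comment> \<open>If \<open>Y 0 > x\<close>, every sum exceeds \<open>x\<close> and the point lies
    in \<open>?C\<close>. Hence the complement of \<open>?C\<close> sits inside \<open>?A\<close>,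
    which reduces it to events with a bounded common shock.\<close>
  also have "space N - ?C = ?A - ?B"
    by fastforce
  also have "N.prob (?A - ?B) = N.prob ?A - N.prob ?B"
    using A B by (intro N.finite_measure_Diff) auto
  \<comment> \<open>With \<open>B = UNIV\<close> every factor of the product is 1.\<close>
  also have "N.prob ?A = (\<Sum>y=0..x. pmf (poisson_pmf (\<theta> 0)) y)"
    using shock[of UNIV] by simp
  also have "N.prob ?B = (\<Sum>y=0..x. pmf (poisson_pmf (\<theta> 0)) y *
      (\<Prod>j=1..d. measure_pmf.prob (poisson_pmf (\<theta> j)) {k. y + k \<in> {x<..}}))"
    by (rule shock)
  also have "(\<Sum>y=0..x. pmf (poisson_pmf (\<theta> 0)) y) - \<dots> = (\<Sum>y=0..x. pmf (poisson_pmf (\<theta> 0)) y *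
      (1 - (\<Prod>j=1..d. measure_pmf.prob (poisson_pmf (\<theta> j)) {k. y + k \<in> {x<..}})))"
    by (simp add: sum_subtractf right_diff_distrib)
  also have "\<dots> = (\<Sum>y=0..x. \<theta> 0 ^ y * exp (- \<theta> 0) *
          (Gamma (real x - real y + 1) ^ d -
            (\<Prod>j=1..d. lower_incomplete_Gamma (real x - real y + 1) (\<theta> j))) /
          (Gamma (real y + 1) * Gamma (real x - real y + 1) ^ d))"
  proof (rule sum.cong)
    fix y assume "y \<in> {0..x}"
    then have y: "y \<le> x" by simp
    have set_eq: "{k. y + k \<in> {x<..}} = {x - y<..}" using y by auto
    have "(\<Prod>j=1..d. lower_incomplete_Gamma (real x - real y + 1) (\<theta> j)) =
        (\<Prod>j=1..d. fact (x - y) * measure_pmf.prob (poisson_pmf (\<theta> j)) {x - y<..})"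
      using \<theta> y lower_incomplete_Gamma_eq_poisson[of _ "x - y"]
      by (intro prod.cong) (auto simp: of_nat_diff)
    also have "\<dots> = fact (x - y) ^ d * (\<Prod>j=1..d. measure_pmf.prob (poisson_pmf (\<theta> j)) {x - y<..})"
      by (simp add: prod.distrib)
    \<comment> \<open>Both terms of the bracket carry \<open>fact (x - y) ^ d\<close>, which then
      cancels against the power of \<open>Gamma\<close> in the denominator.\<close>
    finally have prod_eq: "fact (x - y) ^ d -
        (\<Prod>j=1..d. lower_incomplete_Gamma (real x - real y + 1) (\<theta> j)) =
        fact (x - y) ^ d * (1 - (\<Prod>j=1..d. measure_pmf.prob (poisson_pmf (\<theta> j)) {x - y<..}))"
      by (simp add: right_diff_distrib)
    show "pmf (poisson_pmf (\<theta> 0)) y *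
        (1 - (\<Prod>j=1..d. measure_pmf.prob (poisson_pmf (\<theta> j)) {k. y + k \<in> {x<..}})) =
        \<theta> 0 ^ y * exp (- \<theta> 0) *
          (Gamma (real x - real y + 1) ^ d -
            (\<Prod>j=1..d. lower_incomplete_Gamma (real x - real y + 1) (\<theta> j))) /
          (Gamma (real y + 1) * Gamma (real x - real y + 1) ^ d)"
      unfolding set_eq pmf0 Gamma_diff[OF y] prod_eq by simp
  qed simp
  finally have min: "M.prob {\<omega>\<in>space M. Min ((\<lambda>i. X i \<omega>) ` {1..d}) \<le> x} = \<dots>" .

  have ne: "{1..d} \<noteq> {}" using d by simp
  show ?thesis
    using max min
    by (simp only: cdf_distr_real[OF measurable_Max_image[OF finite_atLeastAtMost ne X]]
        cdf_distr_real[OF measurable_Min_image[OF finite_atLeastAtMost ne X]])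
qed

end
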